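(* Let $\varphi$ be the $13$-uniform morphism on the alphabet $\mathbb{Z}_{\geq 0}$ defined by $\varphi(n) = 0\,0\,0\,0\,0\,0\,0\,0\,1\,0\,0\,0\,(n + 1)$ for all $n \in \mathbb{Z}_{\geq 0}$. Then $\textbf{w}_{9/5} = \varphi^\infty(0)$.
   Context: Words are finite or infinite sequences of letters, indexed from position $0$; a factor is a contiguous subword. Let $a, b$ be relatively prime positive integers. For a nonempty word $v$ whose length is divisible by $b$, define $v^{a/b} = v^{\lfloor a/b \rfloor} v_0 v_1 \cdots v_{t-1}$, where $t = |v|\,(a/b - \lfloor a/b\rfloor)$; such a word is called an $\frac{a}{b}$-power. A word is $\frac{a}{b}$-power-free if none of its factors is an $\frac{a}{b}$-power. For $\frac{a}{b} > 1$, $\textbf{w}_{a/b}$ denotes the lexicographically least infinite word over the alphabet $\mathbb{Z}_{\geq 0}$ that is $\frac{a}{b}$-power-free. A morphism $\varphi$ on an alphabet $\Sigma$ is a map $\Sigma \to \Sigma^*$, extended to words by concatenation; it is $k$-uniform if $|\varphi(c)| = k$ for every letter $c$. If $\varphi(c)$ begins with $c$, $\varphi^\infty(c)$ denotes the infinite fixed point of $\varphi$ beginning with $c$ (the limit of $\varphi^i(c)$). *)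

theory Defs
  imports
    "HOL-Library.Omega_Words_Fun"
    "HOL-Library.Fun_Lexorder"
    "HOL-Library.Sublist"
begin

text \<open>
  Finite words are lists; infinite words are the type \<open>'a word = nat \<Rightarrow> 'a\<close> of
  \<open>Omega_Words_Fun\<close>, whose factors are \<open>w [i \<rightarrow> j] = [w i, \<dots>, w (j - 1)]\<close>.
\<close>

section \<open>Fractional powers\<close>

text \<open>
  Since \<open>a/b - \<lfloor>a/b\<rfloor> = (a mod b)/b\<close>, the length \<open>t\<close> of the partial repetition is
  \<open>length v * (a mod b) div b\<close>; the division is exact whenever \<open>b dvd length v\<close>.
\<close>

definition frac_power :: "nat \<Rightarrow> nat \<Rightarrow> 'a list \<Rightarrow> 'a list" where
  "frac_power a b v =
     concat (replicate (a div b) v) @ take (length v * (a mod b) div b) v"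

definition is_frac_power :: "nat \<Rightarrow> nat \<Rightarrow> 'a list \<Rightarrow> bool" where
  "is_frac_power a b u \<longleftrightarrow> (\<exists>v. v \<noteq> [] \<and> b dvd length v \<and> u = frac_power a b v)"

definition power_free :: "nat \<Rightarrow> nat \<Rightarrow> 'a word \<Rightarrow> bool" where
  "power_free a b w \<longleftrightarrow> (\<forall>i j. \<not> is_frac_power a b (w [i \<rightarrow> j]))"

text \<open>
  The exponent enters as a pair \<open>a\<close>, \<open>b\<close>, to be taken coprime and with \<open>0 < b < a\<close>: the
  condition \<open>b dvd length v\<close> depends on the representation of the fraction.
\<close>

definition is_lex_least_power_free :: "nat \<Rightarrow> nat \<Rightarrow> nat word \<Rightarrow> bool" where
  "is_lex_least_power_free a b w \<longleftrightarrow>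
     power_free a b w \<and> (\<forall>u. power_free a b u \<longrightarrow> u = w \<or> less_fun w u)"

definition lex_least_power_free :: "nat \<Rightarrow> nat \<Rightarrow> nat word" where
  "lex_least_power_free a b = (THE w. is_lex_least_power_free a b w)"


section \<open>Morphisms and their infinite fixed points\<close>

definition morph_ext :: "('a \<Rightarrow> 'b list) \<Rightarrow> 'a list \<Rightarrow> 'b list" where
  "morph_ext \<phi> w = concat (map \<phi> w)"

definition uniform :: "nat \<Rightarrow> ('a \<Rightarrow> 'b list) \<Rightarrow> bool" where
  "uniform k \<phi> \<longleftrightarrow> (\<forall>c. length (\<phi> c) = k)"

text \<open>
  Convergence of finite words to an infinite word: every position is eventually present and
  eventually carries the letter of the limit.
\<close>

definition words_tendsto :: "(nat \<Rightarrow> 'a list) \<Rightarrow> 'a word \<Rightarrow> bool" where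
  "words_tendsto u w \<longleftrightarrow> (\<forall>n. \<forall>\<^sub>F i in sequentially. n < length (u i) \<and> u i ! n = w n)"

definition morph_fixpoint :: "('a \<Rightarrow> 'a list) \<Rightarrow> 'a \<Rightarrow> 'a word" where
  "morph_fixpoint \<phi> c = (THE w. words_tendsto (\<lambda>i. (morph_ext \<phi> ^^ i) [c]) w)"

definition phi95 :: "nat \<Rightarrow> nat list" where
  "phi95 n = [0, 0, 0, 0, 0, 0, 0, 0, 1, 0, 0, 0, n + 1]"


section \<open>The objects above are well defined\<close>

text \<open>
  Existence and uniqueness for the two definite descriptions: the lexicographically least word
  exists for all \<open>0 < b < a\<close>, and the limit defining \<open>morph_fixpoint \<phi> c\<close> exists whenever \<open>\<phi>\<close>
  is \<open>k\<close>-uniform with \<open>k \<ge> 2\<close> and \<open>\<phi> c\<close> begins with \<open>c\<close>.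
\<close>

lemma length_frac_power:
  assumes "b dvd length v"
  shows "b * length (frac_power a b v) = a * length v"
proof -
  from assms obtain m where m: "length v = b * m" by (elim dvdE)
  show ?thesis
  proof (cases "b = 0")
    case False
    then have "a mod b \<le> b" by (simp add: less_imp_le)
    then have "m * (a mod b) \<le> m * b" by (rule mult_le_mono2)
    moreover have "b * m * (a mod b) div b = m * (a mod b)"
      using False by (simp add: mult.assoc)
    ultimately have "length (frac_power a b v) = (a div b) * (b * m) + m * (a mod b)"
      by (simp add: frac_power_def m length_concat sum_list_replicate min.absorb2 mult.commute)
    also have "\<dots> = m * (b * (a div b) + a mod b)"
      by (simp only: distrib_left) (simp add: ac_simps)
    also have "\<dots> = m * a" by simp
    finally show ?thesis by (simp add: m)
  qed (use m in simp)
qed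

lemma power_free_id:
  assumes "0 < b" "b < a"
  shows "power_free a b (\<lambda>n. n)"
  unfolding power_free_def is_frac_power_def
proof (intro allI notI, elim exE conjE)
  fix i j and v :: "nat list"
  assume v: "v \<noteq> []" "b dvd length v" and eq: "(\<lambda>n. n) [i \<rightarrow> j] = frac_power a b v"
  have q: "a div b \<noteq> 0" using assms by (simp add: div_eq_0_iff)
  then obtain q where q: "a div b = Suc q" by (cases "a div b") auto
  define r where "r = concat (replicate q v) @ take (length v * (a mod b) div b) v"
  have split: "frac_power a b v = v @ r" by (simp add: frac_power_def q r_def)
  have "b * length (frac_power a b v) = a * length v" using v by (intro length_frac_power)
  also have "\<dots> > b * length v" using assms v by simp
  finally have "length (frac_power a b v) > length v" by simp
  with split have "r \<noteq> []" by auto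
  then have r_hd: "hd r = hd v"
  proof (cases q)
    case 0
    then have "r = take (length v * (a mod b) div b) v" by (simp add: r_def)
    with \<open>r \<noteq> []\<close> show ?thesis by (auto simp: hd_take)
  next
    case (Suc q')
    then show ?thesis using v by (simp add: r_def)
  qed
  have "distinct (frac_power a b v)"
    unfolding eq[symmetric] subsequence_def by simp
  then have "set v \<inter> set r = {}" unfolding split by simp
  moreover have "hd v \<in> set v" "hd v \<in> set r"
    using v \<open>r \<noteq> []\<close> r_hd hd_in_set[of r] by auto
  ultimately show False by blast
qed

lemma less_fun_linear:
  fixes u w :: "nat word"
  shows "u = w \<or> less_fun u w \<or> less_fun w u"
proof (rule ccontr)
  assume *: "\<not> ?thesis"
  then have ex: "\<exists>n. u n \<noteq> w n" by auto
  define n where "n = (LEAST n. u n \<noteq> w n)"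
  have "u n \<noteq> w n" unfolding n_def using ex by (rule LeastI_ex)
  moreover have "\<forall>k<n. u k = w k" unfolding n_def using not_less_Least by blast
  ultimately have "less_fun u w \<or> less_fun w u"
    unfolding less_fun_def by (metis linorder_neqE_nat)
  with * show False by blast
qed

lemma ex1_lex_least_power_free:
  assumes "0 < b" "b < a"
  shows "\<exists>!w. is_lex_least_power_free a b w"
proof -
  define S :: "nat \<Rightarrow> nat word set" where
    "S = rec_nat {u. power_free a b u} (\<lambda>n T. {u \<in> T. \<forall>v\<in>T. u n \<le> v n})"
  have S0: "S 0 = {u. power_free a b u}"
    and SS: "\<And>n. S (Suc n) = {u \<in> S n. \<forall>v\<in>S n. u n \<le> v n}"
    by (simp_all add: S_def)
  have ne: "S n \<noteq> {}" for n
  proof (induction n)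
    case 0
    then show ?case using power_free_id[OF assms] by (auto simp: S0)
  next
    case (Suc n)
    then obtain u0 where "u0 \<in> S n" by blast
    then obtain u where "u \<in> S n" "\<forall>v. v \<in> S n \<longrightarrow> u n \<le> v n"
      using ex_has_least_nat[of "\<lambda>u. u \<in> S n" u0 "\<lambda>u. u n"] by blast
    then show ?case by (auto simp: SS)
  qed
  define U where "U n = (SOME u. u \<in> S n)" for n
  have U: "U n \<in> S n" for n unfolding U_def using ne some_in_eq by blast
  define w where "w n = U (Suc n) n" for n
  have mono: "n \<le> m \<Longrightarrow> S m \<subseteq> S n" for n m
    by (induction rule: dec_induct) (auto simp: SS)
  have S_pf: "power_free a b u" if "u \<in> S n" for u n
    using that mono[of 0 n] by (auto simp: S0)
  have w_eq: "u k = w k" if "u \<in> S n" "k < n" for u n k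
  proof -
    have "u \<in> S (Suc k)" using that mono[of "Suc k" n] by auto
    moreover have "U (Suc k) \<in> S (Suc k)" by (rule U)
    ultimately show ?thesis unfolding w_def SS by (auto intro: antisym)
  qed
  have pf: "power_free a b w"
    unfolding power_free_def
  proof (intro allI)
    fix i j
    have "w [i \<rightarrow> j] = U j [i \<rightarrow> j]"
      unfolding subsequence_def using w_eq[OF U[of j]] by auto
    then show "\<not> is_frac_power a b (w [i \<rightarrow> j])"
      using S_pf[OF U[of j]] by (simp add: power_free_def)
  qed
  have least: "\<not> less_fun u w" if "power_free a b u" for u
  proof
    assume "less_fun u w"
    then obtain k where k: "u k < w k" "\<And>k'. k' < k \<Longrightarrow> u k' = w k'"
      by (rule less_funE) blast
    have "u \<in> S n" if "n \<le> k" for n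
      using that
    proof (induction n)
      case 0
      then show ?case using \<open>power_free a b u\<close> by (simp add: S0)
    next
      case (Suc n)
      have "u n = U (Suc n) n" using k(2)[of n] Suc.prems by (simp add: w_def)
      then show ?case using Suc U[of "Suc n"] by (auto simp: SS)
    qed
    then have "w k \<le> u k" using U[of "Suc k"] unfolding w_def SS by blast
    with k(1) show False by simp
  qed
  show ?thesis
  proof (rule ex1I[of _ w])
    show "is_lex_least_power_free a b w"
      unfolding is_lex_least_power_free_def using pf least less_fun_linear by blast
  next
    fix w' assume "is_lex_least_power_free a b w'"
    then show "w' = w" unfolding is_lex_least_power_free_def using pf least by blast
  qed
qed

lemma is_lex_least_power_free_lex_least:
  "0 < b \<Longrightarrow> b < a \<Longrightarrow> is_lex_least_power_free a b (lex_least_power_free a b)"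
  unfolding lex_least_power_free_def by (rule theI'[OF ex1_lex_least_power_free])

lemma words_tendsto_unique:
  assumes "words_tendsto u w" "words_tendsto u w'"
  shows "w = w'"
proof
  fix n
  have "\<forall>\<^sub>F i in sequentially. u i ! n = w n \<and> u i ! n = w' n"
    using assms unfolding words_tendsto_def by (auto intro: eventually_elim2)
  then obtain i where "u i ! n = w n \<and> u i ! n = w' n"
    using eventually_happens' sequentially_bot by blast
  then show "w n = w' n" by metis
qed

lemma morph_fixpoint_eqI:
  "words_tendsto (\<lambda>i. (morph_ext \<phi> ^^ i) [c]) w \<Longrightarrow> morph_fixpoint \<phi> c = w"
  unfolding morph_fixpoint_def by (rule the_equality) (auto intro: words_tendsto_unique)

lemma morph_ext_simps [simp]:
  "morph_ext \<phi> [] = []"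
  "morph_ext \<phi> (c # u) = \<phi> c @ morph_ext \<phi> u"
  "morph_ext \<phi> (u @ v) = morph_ext \<phi> u @ morph_ext \<phi> v"
  by (simp_all add: morph_ext_def)

lemma morph_ext_pow_append:
  fixes \<phi> :: "'a \<Rightarrow> 'a list"
  shows "(morph_ext \<phi> ^^ i) (u @ v) = (morph_ext \<phi> ^^ i) u @ (morph_ext \<phi> ^^ i) v"
  by (induction i) simp_all

lemma length_morph_ext: "uniform k \<phi> \<Longrightarrow> length (morph_ext \<phi> u) = k * length u"
  by (induction u) (simp_all add: uniform_def)

lemma length_morph_ext_pow:
  fixes \<phi> :: "'a \<Rightarrow> 'a list"
  shows "uniform k \<phi> \<Longrightarrow> length ((morph_ext \<phi> ^^ i) u) = k ^ i * length u"
  by (induction i) (simp_all add: length_morph_ext)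

lemma morph_ext_pow_prefix:
  assumes "Sublist.prefix [c] (\<phi> c)" "i \<le> j"
  shows "Sublist.prefix ((morph_ext \<phi> ^^ i) [c]) ((morph_ext \<phi> ^^ j) [c])"
  using assms(2)
proof (induction rule: dec_induct)
  case (step j)
  from assms(1) obtain s where s: "\<phi> c = [c] @ s" by (auto elim: prefixE)
  have "(morph_ext \<phi> ^^ Suc j) [c] = (morph_ext \<phi> ^^ j) ([c] @ s)"
    unfolding funpow_Suc_right by (simp add: s)
  also have "\<dots> = (morph_ext \<phi> ^^ j) [c] @ (morph_ext \<phi> ^^ j) s"
    by (rule morph_ext_pow_append)
  finally show ?case using step.IH by (metis prefix_order.trans prefixI)
qed simp

lemma words_tendsto_morph_fixpoint:
  assumes "uniform k \<phi>" "k \<ge> 2" "Sublist.prefix [c] (\<phi> c)"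
  shows "words_tendsto (\<lambda>i. (morph_ext \<phi> ^^ i) [c]) (morph_fixpoint \<phi> c)"
proof -
  define u where "u i = (morph_ext \<phi> ^^ i) [c]" for i
  have len: "n < length (u i)" if "n \<le> i" for n i
  proof -
    have "i < k ^ i" using assms(2) by (intro power_gt_expt) simp
    with that show ?thesis unfolding u_def length_morph_ext_pow[OF assms(1)] by simp
  qed
  have nth: "u i ! n = u n ! n" if "n \<le> i" for n i
    using morph_ext_pow_prefix[of c \<phi> n i, OF assms(3) that] len[of n n]
    unfolding u_def by (auto elim!: prefixE simp: nth_append)
  have "words_tendsto u (\<lambda>n. u n ! n)"
    unfolding words_tendsto_def eventually_sequentially using len nth by blast
  with morph_fixpoint_eqI[of \<phi> c "\<lambda>n. u n ! n"] show ?thesis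
    unfolding u_def by simp
qed

lemma uniform_phi95: "uniform 13 phi95"
  by (simp add: uniform_def phi95_def)

lemma words_tendsto_phi95:
  "words_tendsto (\<lambda>i. (morph_ext phi95 ^^ i) [0]) (morph_fixpoint phi95 0)"
  by (rule words_tendsto_morph_fixpoint[OF uniform_phi95]) (simp_all add: phi95_def)

end

theory Submission
  imports Defs
begin

text \<open>
  A \<open>9/5\<close>-power is a factor of length \<open>9 m\<close> with period \<open>5 m\<close>. In the fixed point \<open>w\<close>, the
  nonzero letters sit exactly at the positions congruent to 8 or 12 modulo 13, and this pattern
  excludes a period \<open>5 m\<close> unless \<open>13\<close> divides \<open>m\<close>. If \<open>m = 13 m'\<close>, restricting to the positions
  congruent to 12 gives a shorter power in \<open>w\<close>, so infinite descent applies.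

  For minimality, every letter \<open>c < w n\<close> must complete a power ending at \<open>n\<close>. For \<open>c = 0\<close> this is
  \<open>000000000\<close> or \<open>000010000\<close>; for \<open>c > 0\<close> it is the image under the morphism of a power that
  \<open>c - 1\<close> completes at the preimage position.
\<close>

section \<open>Powers with exponent between 1 and 2\<close>

text \<open>Here \<open>a div b = 1\<close>, so a power of \<open>v\<close> with
  \<open>length v = b * m\<close> is \<open>v\<close> followed by its own prefix of length
  \<open>(a - b) * m\<close>. Such a word is determined by its length and its period
  \<open>b * m\<close>.\<close>

lemma is_frac_power_iff:
  assumes "b < a" "a < 2 * b"
  shows "is_frac_power a b u \<longleftrightarrow>
    (\<exists>m>0. length u = a * m \<and> (\<forall>k<(a - b) * m. u ! k = u ! (k + b * m)))"
proof -
  have div: "a div b = 1" and mod: "a mod b = a - b"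
    using assms by (auto simp: div_nat_eqI mod_if)
  have fp: "frac_power a b v = v @ take ((a - b) * m) v" if "length v = b * m" for m and v :: "'a list"
    using that assms by (simp add: frac_power_def div mod mult.assoc mult.commute[of m])
  have le: "(a - b) * m \<le> b * m" for m
    using assms by (intro mult_le_mono1) simp
  have len: "b * m + (a - b) * m = a * m" for m
    using assms by (simp add: add_mult_distrib[symmetric])
  show ?thesis
  proof
    assume "is_frac_power a b u"
    then obtain v m where v: "v \<noteq> []" "length v = b * m" "u = frac_power a b v"
      unfolding is_frac_power_def dvd_def by blast
    have "m > 0" using v by (cases m) auto
    moreover have "length u = a * m"
      using v fp[of v m] le[of m] len[of m] by simp
    moreover have "u ! k = u ! (k + b * m)" if "k < (a - b) * m" for k
      using that v fp[of v m] less_le_trans[OF that le] by (simp add: nth_append)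
    ultimately show "\<exists>m>0. length u = a * m \<and> (\<forall>k<(a - b) * m. u ! k = u ! (k + b * m))"
      by blast
  next
    assume "\<exists>m>0. length u = a * m \<and> (\<forall>k<(a - b) * m. u ! k = u ! (k + b * m))"
    then obtain m where m: "m > 0" "length u = a * m"
      "\<And>k. k < (a - b) * m \<Longrightarrow> u ! k = u ! (k + b * m)"
      by blast
    define v where "v = take (b * m) u"
    have v: "length v = b * m"
      using m(2) len[of m] by (simp add: v_def)
    have "u = frac_power a b v"
    proof (rule nth_equalityI)
      show "length u = length (frac_power a b v)"
        using m(2) fp[OF v] v le[of m] len[of m] by simp
    next
      fix i assume i: "i < length u"
      show "u ! i = frac_power a b v ! i"
      proof (cases "i < b * m")
        case True
        then show ?thesis using fp[OF v] v by (simp add: nth_append v_def)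
      next
        case False
        then have k: "i - b * m < (a - b) * m"
          using i m(2) len[of m] by linarith
        then show ?thesis
          using fp[OF v] v False m(3)[OF k] le[of m] by (simp add: nth_append v_def)
      qed
    qed
    moreover have "v \<noteq> []" using v m(1) assms by auto
    ultimately show "is_frac_power a b u"
      unfolding is_frac_power_def using v by auto
  qed
qed

text \<open>Restates power-freeness through positions of the infinite word, so that the rest is
  index arithmetic without lists.\<close>

lemma power_free_iff:
  assumes "b < a" "a < 2 * b"
  shows "power_free a b w \<longleftrightarrow> (\<forall>i. \<forall>m>0. \<exists>k<(a - b) * m. w (i + k) \<noteq> w (i + k + b * m))"
proof -
  have lt: "k + b * m < a * m" if "k < (a - b) * m" for k m
    using that assms by (simp add: diff_mult_distrib)
  have "(\<exists>i j. is_frac_power a b (w [i \<rightarrow> j])) \<longleftrightarrow>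
    (\<exists>i. \<exists>m>0. \<forall>k<(a - b) * m. w (i + k) = w (i + k + b * m))"
  proof safe
    fix i j assume "is_frac_power a b (w [i \<rightarrow> j])"
    then obtain m where m: "m > 0" "j - i = a * m"
      "\<And>k. k < (a - b) * m \<Longrightarrow> (w [i \<rightarrow> j]) ! k = (w [i \<rightarrow> j]) ! (k + b * m)"
      unfolding is_frac_power_iff[OF assms] by auto
    have "w (i + k) = w (i + k + b * m)" if "k < (a - b) * m" for k
      using m(3)[OF that] lt[OF that] m(2) by (simp add: subsequence_def add.assoc)
    then show "\<exists>i. \<exists>m>0. \<forall>k<(a - b) * m. w (i + k) = w (i + k + b * m)"
      using m(1) by blast
  next
    fix i m assume m: "m > 0" "\<forall>k<(a - b) * m. w (i + k) = w (i + k + b * m)"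
    have "(w [i \<rightarrow> i + a * m]) ! k = (w [i \<rightarrow> i + a * m]) ! (k + b * m)" if "k < (a - b) * m" for k
      using m(2) that lt[OF that] by (simp add: subsequence_def add.assoc)
    then show "\<exists>i j. is_frac_power a b (w [i \<rightarrow> j])"
      unfolding is_frac_power_iff[OF assms] using m(1)
      by (intro exI[of _ i] exI[of _ "i + a * m"] exI[of _ m]) auto
  qed
  then show ?thesis unfolding power_free_def by blast
qed

section \<open>The fixed point\<close>

lemma nth_morph_ext:
  assumes "uniform k \<phi>" "n < k * length u"
  shows "morph_ext \<phi> u ! n = \<phi> (u ! (n div k)) ! (n mod k)"
  using assms(2)
proof (induction u arbitrary: n)
  case (Cons c u)
  have len: "length (\<phi> c) = k" using assms(1) by (simp add: uniform_def)
  show ?case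
  proof (cases "n < k")
    case False
    then have "n - k < k * length u" "k > 0" using Cons.prems by (cases k; simp)+
    moreover from this have "n div k = Suc ((n - k) div k)" "n mod k = (n - k) mod k"
      using False by (simp_all add: le_div_geq le_mod_geq)
    ultimately show ?thesis using Cons.IH[of "n - k"] False len by (simp add: nth_append)
  qed (simp add: nth_append len)
qed simp

text \<open>The fixed point letter by letter: position \<open>n\<close> lies in the image of the
  letter at \<open>n div 13\<close>. The recursion ends because residue 12 forces
  \<open>n div 13 < n\<close>.\<close>

fun w95 :: "nat word" where
  "w95 n = (if n mod 13 = 8 then 1 else if n mod 13 = 12 then w95 (n div 13) + 1 else 0)"

declare w95.simps [simp del]

lemma less_13_cases:
  assumes "(r::nat) < 13"
  shows "r \<in> {0, 1, 2, 3, 4, 5, 6, 7, 8, 9, 10, 11, 12}"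
proof -
  have "r \<in> {..<13}" using assms by simp
  also have "{..<13} = {0, 1, 2, 3, 4, 5, 6, 7, 8, 9, 10, 11, 12::nat}"
    by (auto simp: lessThan_nat_numeral)
  finally show ?thesis .
qed

lemma nth_phi95:
  assumes "r < 13"
  shows "phi95 c ! r = (if r = 8 then 1 else if r = 12 then c + 1 else 0)"
  using less_13_cases[OF assms] by (auto simp: phi95_def)

lemma nth_morph_ext_pow_phi95: "n < 13 ^ i \<Longrightarrow> (morph_ext phi95 ^^ i) [0] ! n = w95 n"
proof (induction i arbitrary: n)
  case 0
  then show ?case by (simp add: w95.simps)
next
  case (Suc i)
  let ?u = "(morph_ext phi95 ^^ i) [0]"
  have len: "length ?u = 13 ^ i"
    by (simp add: length_morph_ext_pow[OF uniform_phi95])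
  have "n div 13 < 13 ^ i" using Suc.prems by (simp add: less_mult_imp_div_less)
  then show ?case
    using nth_morph_ext[OF uniform_phi95, of n ?u] Suc len nth_phi95[of "n mod 13"]
    by (simp add: w95.simps[of n])
qed

lemma morph_fixpoint_phi95: "morph_fixpoint phi95 0 = w95"
proof (rule morph_fixpoint_eqI)
  have "n < length ((morph_ext phi95 ^^ i) [0]) \<and> (morph_ext phi95 ^^ i) [0] ! n = w95 n"
    if "n \<le> i" for n i
  proof -
    have "n < 13 ^ i" using power_gt_expt[of 13 i] that by simp
    then show ?thesis
      by (simp add: length_morph_ext_pow[OF uniform_phi95] nth_morph_ext_pow_phi95)
  qed
  then show "words_tendsto (\<lambda>i. (morph_ext phi95 ^^ i) [0]) w95"
    unfolding words_tendsto_def eventually_sequentially by blast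
qed

lemma w95_block:
  "r < 13 \<Longrightarrow> w95 (13 * q + r) = (if r = 8 then 1 else if r = 12 then w95 q + 1 else 0)"
  by (simp add: w95.simps[of "13 * q + r"])

text \<open>The letter \<open>w95 q + 1\<close> is never 0, so the zeros depend on the residue alone
  and periods can be tested modulo 13.\<close>

lemma w95_eq_0_iff: "w95 n = 0 \<longleftrightarrow> n mod 13 \<noteq> 8 \<and> n mod 13 \<noteq> 12"
  by (simp add: w95.simps[of n])

section \<open>Power-freeness\<close>

text \<open>A long enough window meets both residues 8 and 12, so a shift by \<open>5 * m\<close>
  maps each of them into {8, 12}. The first allows only the shifts 0 and 4 modulo 13, the second
  only 0 and 9; hence 13 divides \<open>5 * m\<close>.\<close>

lemma w95_period:
  assumes "m > 0" and eq: "\<forall>k<4 * m. w95 (i + k) = w95 (i + k + 5 * m)"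
  shows "13 dvd m"
proof (rule ccontr)
  assume ndvd: "\<not> 13 dvd m"
  define j where "j = i mod 13"
  have j: "j \<in> {0, 1, 2, 3, 4, 5, 6, 7, 8, 9, 10, 11, 12}"
    unfolding j_def by (rule less_13_cases) simp
  have eq0: "(j + k) mod 13 \<noteq> 8 \<and> (j + k) mod 13 \<noteq> 12 \<longleftrightarrow>
      (j + k + 5 * m) mod 13 \<noteq> 8 \<and> (j + k + 5 * m) mod 13 \<noteq> 12" if "k < 4 * m" for k
  proof -
    have "(i + k) mod 13 = (j + k) mod 13" "(i + k + 5 * m) mod 13 = (j + k + 5 * m) mod 13"
      unfolding j_def by (simp_all add: mod_simps add.assoc)
    then show ?thesis using eq that w95_eq_0_iff by metis
  qed
  \<comment> \<open>For \<open>m\<close> at most 3 the \<open>4 * m\<close> compared positions need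
    not meet every residue, so these cases are checked for each start \<open>j\<close>.\<close>
  consider "m = 1" | "m = 2" | "m = 3" | "m \<ge> 4" using assms(1) by linarith
  then show False
  proof cases
    case 1
    show False
      using j 1 eq0[of 0] eq0[of 1] eq0[of 2] eq0[of 3]
      by (elim insertE) simp_all
  next
    case 2
    show False
      using j 2 eq0[of 0] eq0[of 1] eq0[of 2] eq0[of 3] eq0[of 4] eq0[of 5] eq0[of 6] eq0[of 7]
      by (elim insertE) simp_all
  next
    case 3
    show False
      using j 3 eq0[of 0] eq0[of 1] eq0[of 2] eq0[of 3] eq0[of 4] eq0[of 5] eq0[of 6] eq0[of 7]
        eq0[of 8] eq0[of 9] eq0[of 10] eq0[of 11]
      by (elim insertE) simp_all
  next
    case 4
    \<comment> \<open>The witness is \<open>r - j\<close> modulo 13, with 12 in the role of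
      -1.\<close>
    have "\<exists>k<13. (j + k) mod 13 = r" if "r < 13" for r
      using that by (intro exI[of _ "(r + 12 * j) mod 13"]) (simp add: mod_simps)
    from this[of 8] this[of 12] obtain k l
      where k: "k < 13" "(j + k) mod 13 = 8" and l: "l < 13" "(j + l) mod 13 = 12"
      by auto
    have "(8 + 5 * m) mod 13 = 8 \<or> (8 + 5 * m) mod 13 = 12"
      using eq0[of k] k 4 mod_add_left_eq[of "j + k" 13 "5 * m"] by simp
    moreover have "(12 + 5 * m) mod 13 = 8 \<or> (12 + 5 * m) mod 13 = 12"
      using eq0[of l] l 4 mod_add_left_eq[of "j + l" 13 "5 * m"] by simp
    moreover have "(r + 5 * (m mod 13)) mod 13 = (r + 5 * m) mod 13" for r
      by (metis mod_add_right_eq mod_mult_right_eq)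
    ultimately have "(8 + 5 * (m mod 13)) mod 13 \<in> {8, 12}"
      "(12 + 5 * (m mod 13)) mod 13 \<in> {8, 12}"
      by simp_all
    moreover have "m mod 13 \<noteq> 0" using ndvd by (simp add: mod_eq_0_iff_dvd)
    moreover have "m mod 13 < 13" by simp
    note less_13_cases[OF this]
    ultimately show False by (elim insertE) simp_all
  qed
qed

text \<open>Among \<open>52 * m'\<close> consecutive positions, \<open>4 * m'\<close> have residue
  12, and their letters are those of a factor of \<open>w95\<close> increased by 1.\<close>

lemma w95_no_power: "m > 0 \<Longrightarrow> \<exists>k<4 * m. w95 (i + k) \<noteq> w95 (i + k + 5 * m)"
proof (induction m arbitrary: i rule: less_induct)
  case (less m)
  show ?case
  proof (rule ccontr)
    assume "\<not> ?thesis"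
    then have eq: "\<And>k. k < 4 * m \<Longrightarrow> w95 (i + k) = w95 (i + k + 5 * m)" by blast
    then obtain m' where m': "m = 13 * m'" using w95_period less.prems by (blast elim: dvdE)
    define x where "x = i div 13"
    have x: "i \<le> 13 * x + 12" "13 * x \<le> i"
      using mult_div_mod_eq[of 13 i] mod_less_divisor[of 13 i] unfolding x_def by linarith+
    obtain k where k: "k < 4 * m'" "w95 (x + k) \<noteq> w95 (x + k + 5 * m')"
      using less.IH[of m' x] less.prems m' by auto
    \<comment> \<open>The offset from \<open>i\<close> of the position
      \<open>13 * (x + k) + 12\<close>; the subtraction does not truncate, since \<open>i\<close> is
      at most \<open>13 * x + 12\<close>.\<close>
    have "13 * x + 12 + 13 * k - i < 4 * m" using k(1) x m' by linarith
    from eq[OF this] have "w95 (13 * (x + k) + 12) = w95 (13 * (x + k + 5 * m') + 12)"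
      using x m' by (simp add: algebra_simps)
    with k(2) show False
      using w95_block[of 12 "x + k"] w95_block[of 12 "x + k + 5 * m'"] by simp
  qed
qed

section \<open>Minimality\<close>

text \<open>
  Only the shifted copy reaches position \<open>n\<close>, at \<open>k = 4 * m - 1\<close>; hence the update is needed on
  one side only.
\<close>

lemma w95_smaller_letter_completes_power:
  "c < w95 n \<Longrightarrow> \<exists>i. \<exists>m>0. n + 1 = i + 9 * m \<and>
     (\<forall>k<4 * m. w95 (i + k) = (w95(n := c)) (i + k + 5 * m))"
proof (induction n arbitrary: c rule: less_induct)
  case (less n)
  define q where "q = n div 13"
  have r: "n mod 13 = 8 \<or> n mod 13 = 12" using less.prems w95_eq_0_iff[of n] by auto
  have n: "n = 13 * q + n mod 13" by (simp add: q_def)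
  show ?case
  proof (cases "c = 0")
    case True
    \<comment> \<open>Offsets 0 to 3 are compared with 5 to 8; the letter 1 in
      \<open>000010000\<close> has offset 4 and is never compared.\<close>
    have "w95 (n - 8 + k) = (w95(n := c)) (n - 8 + k + 5)" if k: "k < 4" for k
      using r
    proof
      assume "n mod 13 = 8"
      with n have n: "n = 13 * q + 8" by simp
      then have "n - 8 + k = 13 * q + k" "n - 8 + k + 5 = 13 * q + (k + 5)" by simp_all
      then show ?thesis
        using k True n w95_block[of k q] w95_block[of "k + 5" q] by (simp only: fun_upd_def) simp
    next
      assume "n mod 13 = 12"
      with n have n: "n = 13 * q + 12" by simp
      then have "n - 8 + k = 13 * q + (k + 4)" "n - 8 + k + 5 = 13 * q + (k + 9)" by simp_all
      then show ?thesis
        using k True n w95_block[of "k + 4" q] w95_block[of "k + 9" q] by (simp only: fun_upd_def) simp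
    qed
    moreover have "n \<ge> 8" using n r by linarith
    ultimately show ?thesis by (intro exI[of _ "n - 8"] exI[of _ 1]) auto
  next
    case False
    then have "n mod 13 = 12" using r less.prems by (auto simp: w95.simps[of n])
    with n have n: "n = 13 * q + 12" by simp
    then have "c - 1 < w95 q" using less.prems False by (simp add: w95_block)
    moreover have "q < n" using n by simp
    ultimately obtain i m where im: "m > 0" "q + 1 = i + 9 * m"
      and eq: "\<And>k. k < 4 * m \<Longrightarrow> w95 (i + k) = (w95(q := c - 1)) (i + k + 5 * m)"
      using less.IH by blast
    have "w95 (13 * i + k) = (w95(n := c)) (13 * i + k + 5 * (13 * m))" if "k < 4 * (13 * m)" for k
    proof -
      define y s where "y = k div 13" and "s = k mod 13"
      have k: "k = 13 * y + s" and s: "s < 13" by (simp_all add: y_def s_def)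
      have y: "y < 4 * m" using that k by linarith
      have *: "13 * i + k = 13 * (i + y) + s"
          "13 * i + k + 5 * (13 * m) = 13 * (i + y + 5 * m) + s"
        using k by simp_all
      have "s = 12 \<and> z = q" if "13 * z + s = n" for z
      proof -
        have "z = q" using that s n by linarith
        with that n show ?thesis by simp
      qed
      \<comment> \<open>Writing \<open>c\<close> at \<open>n\<close> is the image of writing
        \<open>c - 1\<close> at \<open>q\<close>: only the last letter of a block depends on the
        preimage, and \<open>c - 1 + 1 = c\<close> because \<open>c\<close> is nonzero.\<close>
      then have upd: "13 * (i + y + 5 * m) + s = n \<longleftrightarrow> s = 12 \<and> i + y + 5 * m = q"
        using n by blast
      then show ?thesis
        unfolding *(2) unfolding *(1) fun_upd_apply upd w95_block[OF s] using eq[OF y] False by auto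
    qed
    moreover have "n + 1 = 13 * i + 9 * (13 * m)" using im(2) n by simp
    ultimately show ?thesis using im(1) by (intro exI[of _ "13 * i"] exI[of _ "13 * m"]) auto
  qed
qed

theorem theorem2p2:
  shows "lex_least_power_free 9 5 = morph_fixpoint phi95 0"
proof -
  have pf: "power_free 9 5 w \<longleftrightarrow> (\<forall>i. \<forall>m>0. \<exists>k<4 * m. w (i + k) \<noteq> w (i + k + 5 * m))"
    for w :: "nat word"
    by (simp add: power_free_iff)
  have not_less: "\<not> less_fun u w95" if "power_free 9 5 u" for u
  proof
    assume "less_fun u w95"
    then obtain n where n: "u n < w95 n" "\<And>k. k < n \<Longrightarrow> u k = w95 k"
      by (rule less_funE) blast
    then obtain i m where m: "m > 0" "n + 1 = i + 9 * m"
      and eq: "\<And>k. k < 4 * m \<Longrightarrow> w95 (i + k) = (w95(n := u n)) (i + k + 5 * m)"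
      using w95_smaller_letter_completes_power by blast
    \<comment> \<open>The power ends exactly at \<open>n\<close>, the first difference, and up to
      there \<open>u\<close> coincides with \<open>w95(n := u n)\<close>.\<close>
    have "u (i + k) = u (i + k + 5 * m)" if "k < 4 * m" for k
    proof -
      have "i + k < n" "i + k + 5 * m \<le> n" using that m by linarith+
      then show ?thesis using eq[OF that] n(2) by (auto simp: le_less split: if_splits)
    qed
    with m(1) \<open>power_free 9 5 u\<close> show False unfolding pf by blast
  qed
  have "is_lex_least_power_free 9 5 w95"
    unfolding is_lex_least_power_free_def
    using pf w95_no_power not_less less_fun_linear by blast
  moreover have "is_lex_least_power_free 9 5 (lex_least_power_free 9 5)"
    by (rule is_lex_least_power_free_lex_least) simp_all
  ultimately have "lex_least_power_free 9 5 = w95"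
    using ex1_lex_least_power_free[of 5 9] by auto
  then show ?thesis by (simp add: morph_fixpoint_phi95)
qed

end
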